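(* Suppose $\alpha_A\le\alpha_B$, $X_A^{o}<\bar X_A<1$, and $\lambda_A\gg\gamma_B>0$ (that is, $\lambda_A$ is sufficiently large). Consider the TIC Agreement. Now assume both countries could deviate from the agreement by choosing arbitrary non-negative subsidies $e_A,e_B,s_A,s_B\ge0$ while all other aspects of the agreement remain legally enforced. Then: (i) Country $A$ has no profitable deviation to any $(e_A,s_A)$ with $e_A>0$ or $s_A>0$. (ii) If $\eta_A=1$, country $B$ has no profitable deviation to any $(e_B,s_B)$ with $e_B>0$ or $s_B>0$. If $\eta_A>1$, there is a threshold $$\gamma_B^{TIC}(\eta_A)=\delta\cdot\frac{\eta_A^2+\eta_A-1}{\eta_A^2-1}$$ such that $B$ has an incentive to raise its export subsidy (i.e. can increase its utility by raising $e_B$ above zero) if and only if $\gamma_B>\gamma_B^{TIC}(\eta_A)$. The threshold satisfies $\lim_{\eta_A\to1}\gamma_B^{TIC}(\eta_A)=\infty$. (iii) For any $(e_B,s_B)$, country $A$'s production satisfies the global bound $X_A\ge 1/\eta_A$ and its direct costs $D_A$ do not increase in the other country's subsidies $e_B$ or $s_B$.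
   Context: There are two countries $A,B$; $i,j\in\{A,B\}$ with $j\ne i$, and every formula for $i$ also holds with $i$ and $j$ swapped. There is a unit mass of products $m\in[0,1]$, each traded on its own independent perfectly competitive market. In each country demand for each product is exactly one unit at every price below a valuation $v$, which is large enough to exceed all equilibrium prices. The technological marginal cost of product $m$ in country $i$ is $w_i(m)$, and $\Delta w_A(m)=w_A(m)-w_B(m)=-\alpha_A+\delta m$, where $\alpha_A,\alpha_B>0$ and $\delta=\alpha_A+\alpha_B$. Instruments of country $i$: production subsidy $s_i\ge 0$, export subsidy $e_i\ge 0$, tariff $\tau_i\ge 0$. Possibly country $i$ has a tradeable import certificate (TIC) scheme with certificate price $\pi_i\ge0$ ($\pi_i=0$ if there is no TIC scheme): each imported unit requires one certificate, each exported unit generates $\eta_i$ certificates (the export credit factor), and exporters keep a share $\phi_i\in[0,1]$ of certificate revenues. Effective tariff: $\tilde\tau_i=\tau_i+\pi_i$. Effective export subsidy: $\tilde e_i=e_i+\phi_i\eta_i\pi_i$. Marginal costs: $c_i^{dom}(m)=w_i(m)-s_i$ for domestic sales and $c_i^{exp}(m)=w_i(m)-s_i-\tilde e_i+\tilde\tau_j$ for exports from $i$ to $j$. Market outcome: $q_i^{dom}(m)=1$ if $c_i^{dom}(m)\le c_j^{exp}(m)$ and $0$ otherwise; $q_i^{exp}(m)=1$ if $c_i^{exp}(m)<c_j^{dom}(m)$ and $0$ otherwise. Aggregates: $Q_i^{dom}=\int_0^1q_i^{dom}(m)\,dm$, $Q_i^{exp}=\int_0^1q_i^{exp}(m)\,dm$,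 $Q_i^{imp}=Q_j^{exp}$, total production $X_i=Q_i^{dom}+Q_i^{exp}$. $X_A^{o}=2\alpha_A/\delta$ is the free trade level of $X_A$. TIC market: if country $i$ has a TIC scheme, equilibrium requires $\eta_iQ_i^{exp}\ge Q_i^{imp}$, and the TIC market is in one of three types of equilibrium: binding ($\pi_i\ge0$ and $\eta_iQ_i^{exp}=Q_i^{imp}>0$), non-binding ($\pi_i=0$, $\eta_iQ_i^{exp}\ge Q_i^{imp}$, $Q_i^{exp}>0$), or pure autarky ($Q_i^{exp}=Q_i^{imp}=0$). Direct costs: $d_i^{dom}(m)=w_i(m)$, $d_i^{imp}(m)=w_j(m)-s_j-\tilde e_j$, $d_i^{exp}(m)=\tilde e_i+s_i$, and $$D_i=\int_0^1\left(d_i^{dom}(m)q_i^{dom}(m)+d_i^{imp}(m)q_j^{exp}(m)+d_i^{exp}(m)q_i^{exp}(m)\right)dm.$$ Country $A$ has a production goal $\bar X_A$ and utility $u_A=-\lambda_A\max(\bar X_A-X_A,0)-D_A$; country $B$ has utility $u_B=\gamma_BX_B-D_B$. "$\lambda_A\gg\gamma_B$" is read as: for given values of the other parameters, $\lambda_A$ is sufficiently large. TIC Agreement: country $A$ implements a TIC scheme with $\eta_A=\frac{2-\bar X_A}{\bar X_A}$ and $\phi_A\eta_A=1$; country $B$ may also implement a TIC scheme with $\eta_B\ge1$; no country uses direct tariffs or subsidies ($\tau_i=e_i=s_i=0$). Deviations are unilateral, from the agreement, and certificate prices adjust to the resulting market equilibrium.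
   Formalization: Where several market equilibria exist, the resulting one is taken to have the smallest certificate prices (for the agreement, all of (ii), and D_A in (iii)), since starting from or jumping to self-fulfilling pure autarky makes the claims false; X̄_A=1 is also allowed. *)

theory Defs
  imports "HOL-Analysis.Analysis"
begin

datatype country = CountryA | CountryB

fun foreign :: "country \<Rightarrow> country" where
  "foreign CountryA = CountryB"
| "foreign CountryB = CountryA"

record tic_scheme =
  credit :: real  (* export credit factor \<eta> *)
  share :: real   (* exporters' share \<phi> of the certificate revenues *)

record policy =
  prod_subsidy :: "country \<Rightarrow> real"
  exp_subsidy :: "country \<Rightarrow> real"
  tariff :: "country \<Rightarrow> real"
  tic :: "country \<Rightarrow> tic_scheme option"

text \<open>
  Throughout, w i m is the technological marginal cost of product m in country i, P the policy of
  both countries, and \<pi> i the price of the certificates of country i.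
\<close>

definition eff_tariff :: "policy \<Rightarrow> (country \<Rightarrow> real) \<Rightarrow> country \<Rightarrow> real" where
  "eff_tariff P \<pi> i = tariff P i + \<pi> i"

definition eff_exp_subsidy :: "policy \<Rightarrow> (country \<Rightarrow> real) \<Rightarrow> country \<Rightarrow> real" where
  "eff_exp_subsidy P \<pi> i = exp_subsidy P i +
     (case tic P i of None \<Rightarrow> 0 | Some T \<Rightarrow> share T * credit T * \<pi> i)"

definition cost_dom ::
    "(country \<Rightarrow> real \<Rightarrow> real) \<Rightarrow> policy \<Rightarrow> country \<Rightarrow> real \<Rightarrow> real" where
  "cost_dom w P i m = w i m - prod_subsidy P i"

definition cost_exp ::
    "(country \<Rightarrow> real \<Rightarrow> real) \<Rightarrow> policy \<Rightarrow> (country \<Rightarrow> real) \<Rightarrow> country \<Rightarrow> real \<Rightarrow> real" where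
  "cost_exp w P \<pi> i m =
     w i m - prod_subsidy P i - eff_exp_subsidy P \<pi> i + eff_tariff P \<pi> (foreign i)"

definition q_dom ::
    "(country \<Rightarrow> real \<Rightarrow> real) \<Rightarrow> policy \<Rightarrow> (country \<Rightarrow> real) \<Rightarrow> country \<Rightarrow> real \<Rightarrow> real" where
  "q_dom w P \<pi> i m = (if cost_dom w P i m \<le> cost_exp w P \<pi> (foreign i) m then 1 else 0)"

definition q_exp ::
    "(country \<Rightarrow> real \<Rightarrow> real) \<Rightarrow> policy \<Rightarrow> (country \<Rightarrow> real) \<Rightarrow> country \<Rightarrow> real \<Rightarrow> real" where
  "q_exp w P \<pi> i m = (if cost_exp w P \<pi> i m < cost_dom w P (foreign i) m then 1 else 0)"

definition Q_dom ::
    "(country \<Rightarrow> real \<Rightarrow> real) \<Rightarrow> policy \<Rightarrow> (country \<Rightarrow> real) \<Rightarrow> country \<Rightarrow> real" where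
  "Q_dom w P \<pi> i = (LINT m:{0..1}|lborel. q_dom w P \<pi> i m)"

definition Q_exp ::
    "(country \<Rightarrow> real \<Rightarrow> real) \<Rightarrow> policy \<Rightarrow> (country \<Rightarrow> real) \<Rightarrow> country \<Rightarrow> real" where
  "Q_exp w P \<pi> i = (LINT m:{0..1}|lborel. q_exp w P \<pi> i m)"

definition Q_imp ::
    "(country \<Rightarrow> real \<Rightarrow> real) \<Rightarrow> policy \<Rightarrow> (country \<Rightarrow> real) \<Rightarrow> country \<Rightarrow> real" where
  "Q_imp w P \<pi> i = Q_exp w P \<pi> (foreign i)"

definition production ::
    "(country \<Rightarrow> real \<Rightarrow> real) \<Rightarrow> policy \<Rightarrow> (country \<Rightarrow> real) \<Rightarrow> country \<Rightarrow> real" where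
  "production w P \<pi> i = Q_dom w P \<pi> i + Q_exp w P \<pi> i"

definition direct_costs ::
    "(country \<Rightarrow> real \<Rightarrow> real) \<Rightarrow> policy \<Rightarrow> (country \<Rightarrow> real) \<Rightarrow> country \<Rightarrow> real" where
  "direct_costs w P \<pi> i =
     (LINT m:{0..1}|lborel.
        w i m * q_dom w P \<pi> i m
        + (w (foreign i) m - prod_subsidy P (foreign i) - eff_exp_subsidy P \<pi> (foreign i))
            * q_exp w P \<pi> (foreign i) m
        + (eff_exp_subsidy P \<pi> i + prod_subsidy P i) * q_exp w P \<pi> i m)"

definition utility_A ::
    "real \<Rightarrow> real \<Rightarrow> (country \<Rightarrow> real \<Rightarrow> real) \<Rightarrow> policy \<Rightarrow> (country \<Rightarrow> real) \<Rightarrow> real" where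
  "utility_A lam Xbar w P \<pi> =
     - lam * max (Xbar - production w P \<pi> CountryA) 0 - direct_costs w P \<pi> CountryA"

definition utility_B ::
    "real \<Rightarrow> (country \<Rightarrow> real \<Rightarrow> real) \<Rightarrow> policy \<Rightarrow> (country \<Rightarrow> real) \<Rightarrow> real" where
  "utility_B gam w P \<pi> =
     gam * production w P \<pi> CountryB - direct_costs w P \<pi> CountryB"

definition tic_binding ::
    "(country \<Rightarrow> real \<Rightarrow> real) \<Rightarrow> policy \<Rightarrow> (country \<Rightarrow> real) \<Rightarrow> country \<Rightarrow> tic_scheme \<Rightarrow> bool" where
  "tic_binding w P \<pi> i T \<longleftrightarrow>
     \<pi> i \<ge> 0 \<and> credit T * Q_exp w P \<pi> i = Q_imp w P \<pi> i \<and> Q_imp w P \<pi> i > 0"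

definition tic_non_binding ::
    "(country \<Rightarrow> real \<Rightarrow> real) \<Rightarrow> policy \<Rightarrow> (country \<Rightarrow> real) \<Rightarrow> country \<Rightarrow> tic_scheme \<Rightarrow> bool" where
  "tic_non_binding w P \<pi> i T \<longleftrightarrow>
     \<pi> i = 0 \<and> credit T * Q_exp w P \<pi> i \<ge> Q_imp w P \<pi> i \<and> Q_exp w P \<pi> i > 0"

definition pure_autarky ::
    "(country \<Rightarrow> real \<Rightarrow> real) \<Rightarrow> policy \<Rightarrow> (country \<Rightarrow> real) \<Rightarrow> country \<Rightarrow> bool" where
  "pure_autarky w P \<pi> i \<longleftrightarrow> Q_exp w P \<pi> i = 0 \<and> Q_imp w P \<pi> i = 0"

definition tic_market_equilibrium ::
    "(country \<Rightarrow> real \<Rightarrow> real) \<Rightarrow> policy \<Rightarrow> (country \<Rightarrow> real) \<Rightarrow> country \<Rightarrow> bool" where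
  "tic_market_equilibrium w P \<pi> i \<longleftrightarrow>
     (case tic P i of
        None \<Rightarrow> \<pi> i = 0
      | Some T \<Rightarrow> \<pi> i \<ge> 0 \<and> credit T * Q_exp w P \<pi> i \<ge> Q_imp w P \<pi> i \<and>
          (tic_binding w P \<pi> i T \<or> tic_non_binding w P \<pi> i T \<or> pure_autarky w P \<pi> i))"

definition equilibrium ::
    "(country \<Rightarrow> real \<Rightarrow> real) \<Rightarrow> policy \<Rightarrow> (country \<Rightarrow> real) \<Rightarrow> bool" where
  "equilibrium w P \<pi> \<longleftrightarrow> (\<forall>i. tic_market_equilibrium w P \<pi> i)"

text \<open>
  A policy can have several equilibria: if country B runs a TIC scheme with share T * credit T < 1,
  prohibitively high prices of both certificates always support pure autarky, whatever other
  equilibria exist.  Where the equilibrium matters, we take the one with minimal certificate prices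
  (componentwise), i.e. prices rise above zero only as far as clearing the markets requires.
\<close>

definition market_outcome ::
    "(country \<Rightarrow> real \<Rightarrow> real) \<Rightarrow> policy \<Rightarrow> (country \<Rightarrow> real) \<Rightarrow> bool" where
  "market_outcome w P \<pi> \<longleftrightarrow>
     equilibrium w P \<pi> \<and> (\<forall>\<pi>'. equilibrium w P \<pi>' \<and> (\<forall>i. \<pi>' i \<le> \<pi> i) \<longrightarrow> \<pi>' = \<pi>)"

text \<open>
  The rules of the TIC Agreement (TB is the optional scheme of country B), when the countries use
  export subsidies eA, eB and production subsidies sA, sB.  Under the agreement all four are 0.
\<close>

definition agreement_credit :: "real \<Rightarrow> real" where
  "agreement_credit Xbar = (2 - Xbar) / Xbar"

definition tic_agreement ::
    "real \<Rightarrow> real \<Rightarrow> tic_scheme option \<Rightarrow> real \<Rightarrow> real \<Rightarrow> real \<Rightarrow> real \<Rightarrow> policy" where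
  "tic_agreement Xbar phiA TB eA sA eB sB =
     \<lparr> prod_subsidy = case_country sA sB,
       exp_subsidy = case_country eA eB,
       tariff = (\<lambda>_. 0),
       tic = case_country (Some \<lparr> credit = agreement_credit Xbar, share = phiA \<rparr>) TB \<rparr>"

definition gamma_B_TIC :: "real \<Rightarrow> real \<Rightarrow> real" where
  "gamma_B_TIC \<delta> \<eta> = \<delta> * ((\<eta>\<^sup>2 + \<eta> - 1) / (\<eta>\<^sup>2 - 1))"

end

theory Submission
  imports Defs
begin

text \<open>
  Every market outcome is described by two cutoffs: A exports the products below \<open>x\<close> and serves its
  own market below \<open>y\<close>.  Production, direct costs and the certificate constraints are then elementary
  functions of \<open>x\<close>, \<open>y\<close> and the prices, and A's scheme demands \<open>1 - y \<le> \<eta>\<^sub>A x\<close>; without subsidies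
  \<open>x = y = x\<^sub>0 = 1 / (1 + \<eta>\<^sub>A)\<close>.

  When only B uses subsidies, there is an equilibrium with \<open>\<pi>\<^sub>B = 0\<close> and binding certificates of A,
  and its prices are below those of every other equilibrium: raising \<open>\<pi>\<^sub>B\<close> or lowering \<open>\<pi>\<^sub>A\<close> lowers \<open>x\<close>
  and \<open>y\<close>, against the constraint.  So the market outcome is unique and explicit, B's utility is a
  concave quadratic in \<open>x\<close> with slope \<open>(\<eta>\<^sub>A - 1) (\<gamma>\<^sub>B - \<gamma>\<^sub>B\<^sup>T\<^sup>I\<^sup>C)\<close> at \<open>x\<^sub>0\<close>, and A's costs decrease in \<open>x\<close>.

  When A deviates, every equilibrium has to be considered.  If \<open>x \<ge> y\<close>, A's costs are at least a
  convex quadratic \<open>F\<close> with \<open>F - F(x\<^sub>0, x\<^sub>0) \<ge> - (\<delta> x\<^sub>0 - \<alpha>\<^sub>A) (2 x\<^sub>0 - x - y)\<close>, so \<open>\<lambda>\<^sub>A \<ge> \<delta> x\<^sub>0 - \<alpha>\<^sub>A\<close>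
  suffices.  If \<open>x < y\<close>, B's certificates have a positive price, hence \<open>x + y \<ge> 1\<close>, and A's costs are at
  least those under the agreement.
\<close>

section \<open>Clipped cutoffs and integrals over the unit interval\<close>

definition clip :: "real \<Rightarrow> real" where
  "clip c = max 0 (min 1 c)"

lemma clip_bounds: "0 \<le> clip c" "clip c \<le> 1"
  by (auto simp: clip_def)

lemma clip_mono: "c \<le> d \<Longrightarrow> clip c \<le> clip d"
  by (auto simp: clip_def)

lemma clip_ge: "0 < clip c \<Longrightarrow> clip c \<le> c"
  by (auto simp: clip_def)

lemma clip_id: "0 \<le> c \<Longrightarrow> c \<le> 1 \<Longrightarrow> clip c = c"
  by (auto simp: clip_def)

text \<open>The strict and the weak cutoff differ from the same closed interval by null sets.\<close>
lemma AE_clip: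
  "AE m in lborel. m \<in> {0..1} \<longrightarrow>
     (m < c \<longleftrightarrow> m \<in> {0..clip c}) \<and> (m \<le> c \<longleftrightarrow> m \<in> {0..clip c})"
  using AE_lborel_singleton[of c] AE_lborel_singleton[of 0] AE_lborel_singleton[of 1]
  by eventually_elim (auto simp: clip_def)

lemma set_integral_indicator_Icc:
  assumes "0 \<le> z" "z \<le> (1::real)"
  shows "set_integrable lborel {0..1} (\<lambda>m. indicator {0..z} m :: real)"
    and "(LINT m:{0..1}|lborel. indicator {0..z} m) = z"
proof -
  have *: "(\<lambda>m. indicator {0..1} m *\<^sub>R (indicator {0..z} m :: real)) = indicator {0..z}"
    using assms by (auto simp: indicator_def fun_eq_iff)
  show "set_integrable lborel {0..1} (\<lambda>m. indicator {0..z} m :: real)"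
    unfolding set_integrable_def * by (simp add: emeasure_lborel_Icc_eq)
  show "(LINT m:{0..1}|lborel. indicator {0..z} m) = z"
    unfolding set_lebesgue_integral_def * using assms by simp
qed

lemma set_integral_one:
  "set_integrable lborel {0..1} (\<lambda>m::real. 1 :: real)"
  "(LINT m:{0..1::real}|lborel. (1 :: real)) = 1"
  by (simp_all add: set_integrable_def set_lebesgue_integral_def emeasure_lborel_Icc_eq)

lemma set_integral_affine_Icc:
  fixes a d :: real
  assumes "0 \<le> z" "z \<le> (1::real)"
  shows "set_integrable lborel {0..1} (\<lambda>m. (d * m - a) * indicator {0..z} m)"
    and "(LINT m:{0..1}|lborel. (d * m - a) * indicator {0..z} m) = d * z\<^sup>2 / 2 - a * z"
proof -
  have *: "(\<lambda>m. indicator {0..1} m *\<^sub>R ((d * m - a) * indicator {0..z} m))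
      = (\<lambda>m. indicator {0..z} m *\<^sub>R (d * m - a))"
    using assms by (auto simp: indicator_def fun_eq_iff)
  have "has_bochner_integral lborel (\<lambda>m. indicator {0..z} m *\<^sub>R (d * m - a))
      ((d * z\<^sup>2 / 2 - a * z) - (d * 0\<^sup>2 / 2 - a * 0))"
    by (rule has_bochner_integral_FTC_Icc)
       (use assms in \<open>auto intro!: derivative_eq_intros continuous_intros
         simp flip: has_real_derivative_iff_has_vector_derivative\<close>)
  then show "set_integrable lborel {0..1} (\<lambda>m. (d * m - a) * indicator {0..z} m)"
    and "(LINT m:{0..1}|lborel. (d * m - a) * indicator {0..z} m) = d * z\<^sup>2 / 2 - a * z"
    unfolding set_integrable_def set_lebesgue_integral_def *
    by (auto simp: has_bochner_integral_iff)
qed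

lemma set_integral_cong_AE_Icc:
  assumes "set_integrable lborel {0..1} (g :: real \<Rightarrow> real)"
    and "set_borel_measurable lborel {0..1} f"
    and "AE m in lborel. m \<in> {0..1} \<longrightarrow> f m = g m"
  shows "(LINT m:{0..1}|lborel. f m) = (LINT m:{0..1}|lborel. g m)"
  unfolding set_lebesgue_integral_def
proof (rule integral_cong_AE)
  show "(\<lambda>m. indicator {0..1} m *\<^sub>R f m) \<in> borel_measurable lborel"
    using assms(2) by (simp add: set_borel_measurable_def)
  show "(\<lambda>m. indicator {0..1} m *\<^sub>R g m) \<in> borel_measurable lborel"
    using assms(1) unfolding set_integrable_def by (rule borel_measurable_integrable)
  show "AE m in lborel. indicator {0..1} m *\<^sub>R f m = indicator {0..1} m *\<^sub>R g m"
    using assms(3) by eventually_elim (auto simp: indicator_def)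
qed

section \<open>Quantities, production and direct costs for an arbitrary policy\<close>

locale ricardian_trade =
  fixes w :: "country \<Rightarrow> real \<Rightarrow> real" and \<alpha>A \<alpha>B \<delta> :: real
  assumes \<alpha>A_pos: "\<alpha>A > 0" and \<alpha>B_pos: "\<alpha>B > 0" and \<delta>_eq: "\<delta> = \<alpha>A + \<alpha>B"
    and w_integrable: "\<And>i. set_integrable lborel {0..1} (w i)"
    and w_diff: "\<And>m. m \<in> {0..1} \<Longrightarrow> w CountryA m - w CountryB m = - \<alpha>A + \<delta> * m"
begin

lemma \<delta>_pos: "\<delta> > 0"
  using \<alpha>A_pos \<alpha>B_pos \<delta>_eq by simp

text \<open>The product at which A's export cost equals B's domestic cost. It may lie outside the
  unit interval; only its clipped value is a quantity.\<close>

definition exp_cut :: "policy \<Rightarrow> (country \<Rightarrow> real) \<Rightarrow> real" where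
  "exp_cut P \<pi> = (\<alpha>A + prod_subsidy P CountryA - prod_subsidy P CountryB
     + eff_exp_subsidy P \<pi> CountryA - eff_tariff P \<pi> CountryB) / \<delta>"

definition dom_cut :: "policy \<Rightarrow> (country \<Rightarrow> real) \<Rightarrow> real" where
  "dom_cut P \<pi> = (\<alpha>A + prod_subsidy P CountryA - prod_subsidy P CountryB
     - eff_exp_subsidy P \<pi> CountryB + eff_tariff P \<pi> CountryA) / \<delta>"

lemma q_eq:
  assumes "m \<in> {0..1}"
  shows "q_exp w P \<pi> CountryA m = (if m < exp_cut P \<pi> then 1 else 0)"
    and "q_dom w P \<pi> CountryB m = (if m < exp_cut P \<pi> then 0 else 1)"
    and "q_dom w P \<pi> CountryA m = (if m \<le> dom_cut P \<pi> then 1 else 0)"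
    and "q_exp w P \<pi> CountryB m = (if m \<le> dom_cut P \<pi> then 0 else 1)"
  using w_diff[OF assms] \<delta>_pos
  by (auto simp: q_exp_def q_dom_def cost_exp_def cost_dom_def exp_cut_def dom_cut_def field_simps)

definition exp_share :: "policy \<Rightarrow> (country \<Rightarrow> real) \<Rightarrow> real" where
  "exp_share P \<pi> = clip (exp_cut P \<pi>)"

definition dom_share :: "policy \<Rightarrow> (country \<Rightarrow> real) \<Rightarrow> real" where
  "dom_share P \<pi> = clip (dom_cut P \<pi>)"

lemma share_bounds:
  "0 \<le> exp_share P \<pi>" "exp_share P \<pi> \<le> 1" "0 \<le> dom_share P \<pi>" "dom_share P \<pi> \<le> 1"
  by (simp_all add: exp_share_def dom_share_def clip_bounds)

lemma AE_q:
  "AE m in lborel. m \<in> {0..1} \<longrightarrow>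
      q_exp w P \<pi> CountryA m = indicator {0..exp_share P \<pi>} m
    \<and> q_dom w P \<pi> CountryB m = 1 - indicator {0..exp_share P \<pi>} m
    \<and> q_dom w P \<pi> CountryA m = indicator {0..dom_share P \<pi>} m
    \<and> q_exp w P \<pi> CountryB m = 1 - indicator {0..dom_share P \<pi>} m"
  using AE_clip[of "exp_cut P \<pi>"] AE_clip[of "dom_cut P \<pi>"]
  by eventually_elim (auto simp: q_eq exp_share_def dom_share_def)

text \<open>\<open>lborel\<close> is not complete, so agreement almost everywhere as in
  \<open>AE_q\<close> does not give measurability. On the unit interval these functions agree
  everywhere with indicators of half-lines or with their complements.\<close>

lemma q_set_borel_measurable:
  "set_borel_measurable lborel {0..1} (q_exp w P \<pi> i)"
  "set_borel_measurable lborel {0..1} (q_dom w P \<pi> i)"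
proof -
  have 1: "(\<lambda>m. indicator {0..1} m *\<^sub>R q_exp w P \<pi> i m) = (\<lambda>m. indicator {0..1} m *\<^sub>R
      (case i of CountryA \<Rightarrow> indicator {..<exp_cut P \<pi>} m
        | CountryB \<Rightarrow> 1 - indicator {..dom_cut P \<pi>} m))"
    by (cases i) (auto simp: fun_eq_iff indicator_def q_eq)
  have 2: "(\<lambda>m. indicator {0..1} m *\<^sub>R q_dom w P \<pi> i m) = (\<lambda>m. indicator {0..1} m *\<^sub>R
      (case i of CountryA \<Rightarrow> indicator {..dom_cut P \<pi>} m
        | CountryB \<Rightarrow> 1 - indicator {..<exp_cut P \<pi>} m))"
    by (cases i) (auto simp: fun_eq_iff indicator_def q_eq)
  show "set_borel_measurable lborel {0..1} (q_exp w P \<pi> i)"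
    unfolding set_borel_measurable_def 1 by (cases i) simp_all
  show "set_borel_measurable lborel {0..1} (q_dom w P \<pi> i)"
    unfolding set_borel_measurable_def 2 by (cases i) simp_all
qed

text \<open>Both countries' cost integrands take this shape once \<open>w CountryA\<close> is
  replaced by \<open>w CountryB\<close> plus the affine gap; \<open>z\<close> is
  \<open>dom_share\<close> for A and \<open>exp_share\<close> for B. The integral of
  \<open>w CountryB\<close> stays symbolic and cancels in every comparison.\<close>

lemma set_integral_cost_pieces:
  fixes x y z p q :: real
  assumes "0 \<le> x" "x \<le> 1" "0 \<le> y" "y \<le> 1" "0 \<le> z" "z \<le> 1"
  defines "f \<equiv> \<lambda>m. w CountryB m + (\<delta> * m - \<alpha>A) * indicator {0..z} m
      + p * indicator {0..x} m + q * (1 - indicator {0..y} m)"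
  shows "set_integrable lborel {0..1} f"
    and "(LINT m:{0..1}|lborel. f m)
      = (LINT m:{0..1}|lborel. w CountryB m) + (\<delta> * z\<^sup>2 / 2 - \<alpha>A * z) + p * x + q * (1 - y)"
proof -
  note I = w_integrable[of CountryB] set_integral_affine_Icc(1)[OF assms(5,6), of \<delta> \<alpha>A]
    set_integral_indicator_Icc(1)[OF assms(1,2)] set_integral_indicator_Icc(1)[OF assms(3,4)]
  show "set_integrable lborel {0..1} f"
    unfolding f_def by (intro set_integral_add set_integral_diff set_integrable_mult_right
        set_integral_one I)
  show "(LINT m:{0..1}|lborel. f m)
      = (LINT m:{0..1}|lborel. w CountryB m) + (\<delta> * z\<^sup>2 / 2 - \<alpha>A * z) + p * x + q * (1 - y)"
    unfolding f_def
    using assms I set_integral_one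
    by (simp add: set_integral_add set_integral_diff set_integrable_mult_right
        set_integral_indicator_Icc(2) set_integral_affine_Icc(2))
qed

lemma Q_eq:
  "Q_exp w P \<pi> CountryA = exp_share P \<pi>"
  "Q_exp w P \<pi> CountryB = 1 - dom_share P \<pi>"
  "Q_dom w P \<pi> CountryA = dom_share P \<pi>"
  "Q_dom w P \<pi> CountryB = 1 - exp_share P \<pi>"
proof -
  have direct: "(LINT m:{0..1}|lborel. f m) = z"
    if "AE m in lborel. m \<in> {0..1} \<longrightarrow> f m = indicator {0..z} m" "0 \<le> z" "z \<le> 1"
      "set_borel_measurable lborel {0..1} f" for f :: "real \<Rightarrow> real" and z
    using set_integral_cong_AE_Icc[OF set_integral_indicator_Icc(1)[of z] that(4,1)] that(2,3)
    by (simp add: set_integral_indicator_Icc(2))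
  have compl: "(LINT m:{0..1}|lborel. f m) = 1 - z"
    if "AE m in lborel. m \<in> {0..1} \<longrightarrow> f m = 1 - indicator {0..z} m" "0 \<le> z" "z \<le> 1"
      "set_borel_measurable lborel {0..1} f" for f :: "real \<Rightarrow> real" and z
    using set_integral_cong_AE_Icc[OF set_integral_diff(1)[OF set_integral_one(1)
        set_integral_indicator_Icc(1)[of z]] that(4,1)] that(2,3) set_integral_one
    by (simp add: set_integral_indicator_Icc set_integral_diff(2))
  show "Q_exp w P \<pi> CountryA = exp_share P \<pi>" "Q_dom w P \<pi> CountryA = dom_share P \<pi>"
    unfolding Q_exp_def Q_dom_def
    by (rule direct; use AE_q[of P \<pi>] in
        \<open>auto simp: share_bounds q_set_borel_measurable elim: eventually_mono\<close>)+
  show "Q_exp w P \<pi> CountryB = 1 - dom_share P \<pi>" "Q_dom w P \<pi> CountryB = 1 - exp_share P \<pi>"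
    unfolding Q_exp_def Q_dom_def
    by (rule compl; use AE_q[of P \<pi>] in
        \<open>auto simp: share_bounds q_set_borel_measurable elim: eventually_mono\<close>)+
qed

lemma production_eq:
  "production w P \<pi> CountryA = dom_share P \<pi> + exp_share P \<pi>"
  "production w P \<pi> CountryB = 2 - dom_share P \<pi> - exp_share P \<pi>"
  by (simp_all add: production_def Q_eq)

lemma cost_integrand_measurable:
  "set_borel_measurable lborel {0..1}
    (\<lambda>m. w i m * q_dom w P \<pi> i m + (w j m - k - l) * q_exp w P \<pi> j m
        + c * q_exp w P \<pi> i m)"
proof -
  \<comment> \<open>Outside the interval the constants \<open>k\<close>, \<open>l\<close> and
    \<open>c\<close> survive on the right, but each multiplies a vanishing factor.\<close>
  have *: "(\<lambda>m. indicator {0..1} m *\<^sub>R (w i m * q_dom w P \<pi> i m + (w j m - k - l) * q_exp w P \<pi> j m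
        + c * q_exp w P \<pi> i m))
    = (\<lambda>m. (indicator {0..1} m *\<^sub>R w i m) * (indicator {0..1} m *\<^sub>R q_dom w P \<pi> i m)
       + ((indicator {0..1} m *\<^sub>R w j m) - k - l) * (indicator {0..1} m *\<^sub>R q_exp w P \<pi> j m)
       + c * (indicator {0..1} m *\<^sub>R q_exp w P \<pi> i m))"
    by (auto simp: indicator_def)
  have w: "(\<lambda>m. indicator {0..1} m *\<^sub>R w i m) \<in> borel_measurable lborel" for i
    using w_integrable[of i] unfolding set_integrable_def by (rule borel_measurable_integrable)
  note q = q_set_borel_measurable[unfolded set_borel_measurable_def]
  show ?thesis
    unfolding set_borel_measurable_def *
    by (intro borel_measurable_add borel_measurable_times borel_measurable_diff w q
        borel_measurable_const)
qed

lemma direct_costs_eq: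
  "direct_costs w P \<pi> CountryA = (LINT m:{0..1}|lborel. w CountryB m)
     + (\<delta> * (dom_share P \<pi>)\<^sup>2 / 2 - \<alpha>A * dom_share P \<pi>)
     + (eff_exp_subsidy P \<pi> CountryA + prod_subsidy P CountryA) * exp_share P \<pi>
     - (prod_subsidy P CountryB + eff_exp_subsidy P \<pi> CountryB) * (1 - dom_share P \<pi>)" (is ?A)
  "direct_costs w P \<pi> CountryB = (LINT m:{0..1}|lborel. w CountryB m)
     + (\<delta> * (exp_share P \<pi>)\<^sup>2 / 2 - \<alpha>A * exp_share P \<pi>)
     - (prod_subsidy P CountryA + eff_exp_subsidy P \<pi> CountryA) * exp_share P \<pi>
     + (eff_exp_subsidy P \<pi> CountryB + prod_subsidy P CountryB) * (1 - dom_share P \<pi>)" (is ?B)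
proof -
  let ?p = "eff_exp_subsidy P \<pi> CountryA + prod_subsidy P CountryA"
  let ?q = "prod_subsidy P CountryB + eff_exp_subsidy P \<pi> CountryB"
  note cuts = share_bounds[of P \<pi>]
  have AEA: "AE m in lborel. m \<in> {0..1} \<longrightarrow>
      w CountryA m * q_dom w P \<pi> CountryA m
        + (w CountryB m - prod_subsidy P CountryB - eff_exp_subsidy P \<pi> CountryB)
            * q_exp w P \<pi> CountryB m
        + ?p * q_exp w P \<pi> CountryA m
      = w CountryB m + (\<delta> * m - \<alpha>A) * indicator {0..dom_share P \<pi>} m
        + ?p * indicator {0..exp_share P \<pi>} m + (-?q) * (1 - indicator {0..dom_share P \<pi>} m)"
    using AE_q[of P \<pi>]
  proof eventually_elim
    case (elim m)
    show ?case
    proof (rule impI, goal_cases)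
      case m: 1
      have wA: "w CountryA m = w CountryB m + (\<delta> * m - \<alpha>A)"
        using w_diff[OF m] by simp
      show ?case
        by (simp only: elim[rule_format, OF m] wA) (simp add: algebra_simps)
    qed
  qed
  have AEB: "AE m in lborel. m \<in> {0..1} \<longrightarrow>
      w CountryB m * q_dom w P \<pi> CountryB m
        + (w CountryA m - prod_subsidy P CountryA - eff_exp_subsidy P \<pi> CountryA)
            * q_exp w P \<pi> CountryA m
        + (eff_exp_subsidy P \<pi> CountryB + prod_subsidy P CountryB) * q_exp w P \<pi> CountryB m
      = w CountryB m + (\<delta> * m - \<alpha>A) * indicator {0..exp_share P \<pi>} m
        + (-?p) * indicator {0..exp_share P \<pi>} m + ?q * (1 - indicator {0..dom_share P \<pi>} m)"
    using AE_q[of P \<pi>]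
  proof eventually_elim
    case (elim m)
    show ?case
    proof (rule impI, goal_cases)
      case m: 1
      have wA: "w CountryA m = w CountryB m + (\<delta> * m - \<alpha>A)"
        using w_diff[OF m] by simp
      show ?case
        by (simp only: elim[rule_format, OF m] wA) (simp add: algebra_simps)
    qed
  qed
  show ?A
    unfolding direct_costs_def foreign.simps
    by (subst set_integral_cong_AE_Icc[OF set_integral_cost_pieces(1) cost_integrand_measurable AEA])
       (use cuts in \<open>simp_all add: set_integral_cost_pieces(2)\<close>, simp add: algebra_simps)
  show ?B
    unfolding direct_costs_def foreign.simps
    by (subst set_integral_cong_AE_Icc[OF set_integral_cost_pieces(1) cost_integrand_measurable AEB])
       (use cuts in \<open>simp_all add: set_integral_cost_pieces(2)\<close>, simp add: algebra_simps)
qed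

end

section \<open>The limit of the threshold, and two quadratic inequalities for A's costs\<close>

lemma all_country: "(\<forall>i. R i) \<longleftrightarrow> R CountryA \<and> R CountryB"
  by (metis country.exhaust)

text \<open>The numerator tends to \<open>\<delta> > 0\<close>, the denominator to zero from
  above.\<close>

lemma gamma_B_TIC_at_top:
  assumes "\<delta> > 0"
  shows "filterlim (gamma_B_TIC \<delta>) at_top (at_right 1)"
proof -
  have lim: "((\<lambda>\<eta>. \<delta> * (\<eta>\<^sup>2 + \<eta> - 1)) \<longlongrightarrow> \<delta> * (1\<^sup>2 + 1 - 1)) (at_right 1)"
    "((\<lambda>\<eta>::real. \<eta>\<^sup>2 - 1) \<longlongrightarrow> 1\<^sup>2 - 1) (at_right 1)"
    by (intro tendsto_intros)+
  have pos: "\<forall>\<^sub>F \<eta> in at_right 1. 0 < (\<eta>::real)\<^sup>2 - 1"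
    by (rule eventually_at_right_less[THEN eventually_mono]) (simp add: power2_eq_square less_1_mult)
  have "filterlim (\<lambda>\<eta>. inverse (\<eta>\<^sup>2 - 1 :: real)) at_top (at_right 1)"
    using lim(2) pos by (intro filterlim_inverse_at_top) auto
  from filterlim_tendsto_pos_mult_at_top[OF lim(1) _ this] assms
  show ?thesis
    by (simp add: gamma_B_TIC_def[abs_def] divide_inverse mult.assoc)
qed

text \<open>Expand the right side around \<open>(x0, x0)\<close>. The weight
  \<open>\<delta> * x0 - a\<close> is the marginal cost in \<open>y\<close> there, so the linear
  term in \<open>y - x0\<close> vanishes. The linear term in \<open>x - x0\<close> has coefficient
  \<open>\<delta> * x0\<close>, and \<open>1 - x \<le> 1 - y \<le> \<eta> * x\<close> forces
  \<open>x0 \<le> x\<close>.\<close>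

lemma cost_bound_exports_ge:
  fixes x y x0 \<eta> \<delta> a :: real
  assumes "\<eta> \<ge> 1" "x0 = 1 / (1 + \<eta>)" "0 \<le> y" "y \<le> x" "1 - y \<le> \<eta> * x"
    and "0 < \<delta>" "a \<le> \<delta> * x0"
  shows "3 / 2 * \<delta> * x0\<^sup>2 - 2 * a * x0
    \<le> \<delta> * y\<^sup>2 / 2 - a * y + (\<delta> * x - a) * x + (\<delta> * x0 - a) * max (2 * x0 - (x + y)) 0"
proof -
  have x0: "(1 + \<eta>) * x0 = 1" "x0 > 0" using assms by auto
  have "(1 + \<eta>) * x0 \<le> (1 + \<eta>) * x" using assms x0 by (simp add: algebra_simps)
  then have x: "x0 \<le> x" by (rule mult_left_le_imp_le) (use assms in simp)
  have slack: "(\<delta> * x0 - a) * (2 * x0 - (x + y)) \<le> (\<delta> * x0 - a) * max (2 * x0 - (x + y)) 0"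
    using assms by (intro mult_left_mono) auto
  have "\<delta> * y\<^sup>2 / 2 - a * y + (\<delta> * x - a) * x + (\<delta> * x0 - a) * (2 * x0 - (x + y))
      - (3 / 2 * \<delta> * x0\<^sup>2 - 2 * a * x0)
    = \<delta> * (y - x0)\<^sup>2 / 2 + \<delta> * (x - x0)\<^sup>2 + \<delta> * x0 * (x - x0)"
    by (simp add: field_simps power2_eq_square)
  also have "\<dots> \<ge> 0" using assms x x0 by simp
  finally show ?thesis using slack by linarith
qed

text \<open>Both sides are compared with \<open>3 / 8 * \<delta> - a\<close>, the common value at
  \<open>x = y = x0 = 1 / 2\<close>. On the right, \<open>x\<close> is first lowered to
  \<open>1 - y\<close>, which leaves a quadratic in \<open>y\<close> alone.\<close>

lemma cost_bound_exports_less: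
  fixes x y x0 \<delta> a :: real
  assumes "0 \<le> x" "x < y" "y \<le> 1" "1 \<le> x + y" "0 < \<delta>" "a \<le> \<delta> * x0" "x0 \<le> 1 / 2"
  shows "3 / 2 * \<delta> * x0\<^sup>2 - 2 * a * x0 \<le> \<delta> * y\<^sup>2 / 2 - a * y + (\<delta> * y - a) * x"
proof -
  have "\<delta> * x0 \<le> \<delta> * (1 / 2)"
    using assms by (intro mult_left_mono) auto
  then have a: "a \<le> \<delta> / 2" using assms(6) by linarith
  have y: "y > 1 / 2" using assms by simp
  have "(1 / 2 - x0) * (3 / 2 * \<delta> * (1 / 2 + x0) - 2 * a) \<ge> 0"
    using assms a by (intro mult_nonneg_nonneg) (auto simp: algebra_simps)
  then have 1: "3 / 2 * \<delta> * x0\<^sup>2 - 2 * a * x0 \<le> 3 / 8 * \<delta> - a"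
    by (simp add: field_simps power2_eq_square)
  have "\<delta> * (1 / 2) \<le> \<delta> * y" using assms y by (intro mult_left_mono) auto
  with a have "0 \<le> \<delta> * y - a" by linarith
  then have "(\<delta> * y - a) * (1 - y) \<le> (\<delta> * y - a) * x"
    using assms by (intro mult_left_mono) auto
  moreover have "\<delta> * y\<^sup>2 / 2 - a * y + (\<delta> * y - a) * (1 - y) - (3 / 8 * \<delta> - a)
      = \<delta> / 2 * ((y - 1 / 2) * (3 / 2 - y))"
    by (simp add: field_simps power2_eq_square)
  moreover have "\<dots> \<ge> 0" using assms y by (intro mult_nonneg_nonneg) auto
  ultimately show ?thesis using 1 by linarith
qed

section \<open>Equilibria under the agreement's rules\<close>

locale tic_agreement_setting = ricardian_trade +
  fixes XA_bar \<phi>A \<eta>A :: real and TB :: "tic_scheme option"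
  assumes goal_gt: "2 * \<alpha>A / \<delta> < XA_bar" and goal_le: "XA_bar \<le> 1"
    and \<eta>A_eq: "\<eta>A = agreement_credit XA_bar"
    and \<phi>A_\<eta>A: "\<phi>A * \<eta>A = 1"
    and TB_bounds: "\<And>T. TB = Some T \<Longrightarrow> credit T \<ge> 1 \<and> share T \<in> {0..1}"
begin

abbreviation pol :: "real \<Rightarrow> real \<Rightarrow> real \<Rightarrow> real \<Rightarrow> policy" where
  "pol \<equiv> tic_agreement XA_bar \<phi>A TB"

definition x0 :: real where
  "x0 = 1 / (1 + \<eta>A)"

text \<open>The paper's \<open>\<phi>\<^sub>B\<eta>\<^sub>B\<close>; it may exceed 1.\<close>
definition passB :: real where
  "passB = (case TB of None \<Rightarrow> 0 | Some T \<Rightarrow> share T * credit T)"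

abbreviation W :: real where
  "W \<equiv> (LINT m:{0..1}|lborel. w CountryB m)"

lemma goal_pos: "XA_bar > 0"
proof -
  have "0 < 2 * \<alpha>A / \<delta>" using \<alpha>A_pos \<delta>_pos by simp
  then show ?thesis using goal_gt by linarith
qed

text \<open>The credit factor is tuned so that the outcome \<open>x = y = x0\<close> meets A's goal
  exactly.\<close>

lemma goal_eq: "XA_bar = 2 * x0"
proof -
  have "1 + \<eta>A = 2 / XA_bar"
    using goal_pos by (simp add: \<eta>A_eq agreement_credit_def field_simps)
  then show ?thesis by (simp add: x0_def)
qed

lemma \<eta>A_ge_1: "\<eta>A \<ge> 1"
  using goal_pos goal_le by (simp add: \<eta>A_eq agreement_credit_def)

lemma x0_bounds: "0 < x0" "x0 \<le> 1 / 2" "\<alpha>A < \<delta> * x0"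
  using goal_pos goal_le goal_gt \<delta>_pos by (auto simp: goal_eq field_simps)

lemma passB_nonneg: "passB \<ge> 0"
  using TB_bounds by (force simp: passB_def split: option.splits)

text \<open>Because \<open>\<phi>A * \<eta>A = 1\<close>, A's certificate price shifts both cutoffs
  equally, like a production subsidy of A. B's price lowers both, the second one with weight
  \<open>passB\<close>.\<close>

lemma cuts:
  "exp_cut (pol eA sA eB sB) \<pi>
    = (\<alpha>A + sA - sB + eA + \<pi> CountryA - \<pi> CountryB) / \<delta>"
  "dom_cut (pol eA sA eB sB) \<pi>
    = (\<alpha>A + sA - sB - eB - passB * \<pi> CountryB + \<pi> CountryA) / \<delta>"
  using \<phi>A_\<eta>A
  by (simp_all add: exp_cut_def dom_cut_def eff_exp_subsidy_def eff_tariff_def tic_agreement_def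
      passB_def \<eta>A_eq split: option.splits)

lemma costs:
  "direct_costs w (pol eA sA eB sB) \<pi> CountryA = W
     + (\<delta> * (dom_share (pol eA sA eB sB) \<pi>)\<^sup>2 / 2 - \<alpha>A * dom_share (pol eA sA eB sB) \<pi>)
     + (eA + \<pi> CountryA + sA) * exp_share (pol eA sA eB sB) \<pi>
     - (sB + eB + passB * \<pi> CountryB) * (1 - dom_share (pol eA sA eB sB) \<pi>)" (is ?A)
  "direct_costs w (pol eA sA eB sB) \<pi> CountryB = W
     + (\<delta> * (exp_share (pol eA sA eB sB) \<pi>)\<^sup>2 / 2 - \<alpha>A * exp_share (pol eA sA eB sB) \<pi>)
     - (eA + \<pi> CountryA + sA) * exp_share (pol eA sA eB sB) \<pi>
     + (sB + eB + passB * \<pi> CountryB) * (1 - dom_share (pol eA sA eB sB) \<pi>)" (is ?B)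
proof -
  have "eff_exp_subsidy (pol eA sA eB sB) \<pi> CountryA = eA + \<pi> CountryA"
    "eff_exp_subsidy (pol eA sA eB sB) \<pi> CountryB = eB + passB * \<pi> CountryB"
    "prod_subsidy (pol eA sA eB sB) CountryA = sA" "prod_subsidy (pol eA sA eB sB) CountryB = sB"
    using \<phi>A_\<eta>A
    by (simp_all add: eff_exp_subsidy_def tic_agreement_def passB_def \<eta>A_eq split: option.splits)
  then show ?A ?B
    by (simp_all add: direct_costs_eq algebra_simps)
qed

lemma equilibrium_iff:
  fixes eA sA eB sB :: real and \<pi> :: "country \<Rightarrow> real"
  defines "x \<equiv> exp_share (pol eA sA eB sB) \<pi>" and "y \<equiv> dom_share (pol eA sA eB sB) \<pi>"
  shows "equilibrium w (pol eA sA eB sB) \<pi> \<longleftrightarrow>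
    \<pi> CountryA \<ge> 0 \<and> 1 - y \<le> \<eta>A * x \<and>
    (\<eta>A * x = 1 - y \<and> 1 - y > 0 \<or> \<pi> CountryA = 0 \<and> x > 0 \<or> x = 0 \<and> y = 1) \<and>
    (case TB of None \<Rightarrow> \<pi> CountryB = 0 | Some T \<Rightarrow> \<pi> CountryB \<ge> 0 \<and> x \<le> credit T * (1 - y) \<and>
      (credit T * (1 - y) = x \<and> x > 0 \<or> \<pi> CountryB = 0 \<and> 1 - y > 0 \<or> x = 0 \<and> y = 1))"
proof -
  have "tic (pol eA sA eB sB) CountryA = Some \<lparr>credit = \<eta>A, share = \<phi>A\<rparr>"
    "tic (pol eA sA eB sB) CountryB = TB"
    by (simp_all add: tic_agreement_def \<eta>A_eq)
  then show ?thesis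
    unfolding equilibrium_def all_country x_def y_def
    by (auto simp: tic_market_equilibrium_def tic_binding_def tic_non_binding_def pure_autarky_def
        Q_imp_def Q_eq split: option.split)
qed

lemma equilibrium_constraints:
  assumes "equilibrium w (pol eA sA eB sB) \<pi>"
  shows "\<pi> CountryA \<ge> 0" "\<pi> CountryB \<ge> 0"
    and "1 - dom_share (pol eA sA eB sB) \<pi> \<le> \<eta>A * exp_share (pol eA sA eB sB) \<pi>"
  using assms by (auto simp: equilibrium_iff split: option.splits)

text \<open>A's own scheme gives \<open>1 \<le> \<eta>A * x + y\<close>, and the right side is at
  most \<open>\<eta>A * (x + y)\<close>.\<close>

lemma production_A_ge:
  assumes "equilibrium w (pol eA sA eB sB) \<pi>"
  shows "production w (pol eA sA eB sB) \<pi> CountryA \<ge> 1 / \<eta>A"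
proof -
  let ?x = "exp_share (pol eA sA eB sB) \<pi>" and ?y = "dom_share (pol eA sA eB sB) \<pi>"
  have "?y \<le> \<eta>A * ?y"
    using share_bounds(3) \<eta>A_ge_1 mult_right_mono[of 1 \<eta>A ?y] by simp
  then have "1 \<le> (?y + ?x) * \<eta>A"
    using equilibrium_constraints(3)[OF assms] by (simp add: algebra_simps)
  then show ?thesis using \<eta>A_ge_1 by (simp add: production_eq divide_le_eq)
qed

section \<open>Deviations of A\<close>

text \<open>The left side is A's cost under the agreement, where the goal is met. So at the weight
  \<open>\<delta> * x0 - \<alpha>A\<close> on missed production no equilibrium after a deviation is
  better for A.\<close>

lemma deviation_A_costs:
  assumes eq: "equilibrium w (pol eA sA 0 0) \<pi>" and "eA \<ge> 0" "sA \<ge> 0"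
  shows "W + (3 / 2 * \<delta> * x0\<^sup>2 - 2 * \<alpha>A * x0)
    \<le> direct_costs w (pol eA sA 0 0) \<pi> CountryA
      + (\<delta> * x0 - \<alpha>A) * max (XA_bar - production w (pol eA sA 0 0) \<pi> CountryA) 0"
proof -
  define x where "x = exp_share (pol eA sA 0 0) \<pi>"
  define y where "y = dom_share (pol eA sA 0 0) \<pi>"
  define pA where "pA = \<pi> CountryA"
  define pB where "pB = \<pi> CountryB"
  note defs = x_def y_def pA_def pB_def
  note E = equilibrium_constraints[OF eq, folded defs]
  note b = share_bounds[of "pol eA sA 0 0" \<pi>, folded defs]
  \<comment> \<open>Clipping at 1 may bind, so this is only an inequality; it bounds A's outlay per
    exported unit from below.\<close>
  have xcut: "\<delta> * x \<le> \<alpha>A + sA + eA + pA - pB" if "x > 0"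
    using clip_ge[of "exp_cut (pol eA sA 0 0) \<pi>"] that \<delta>_pos
    by (simp add: defs exp_share_def cuts field_simps)
  have ycut: "\<delta> * y \<le> \<alpha>A + sA - passB * pB + pA" if "y > 0"
    using clip_ge[of "dom_cut (pol eA sA 0 0) \<pi>"] that \<delta>_pos
    by (simp add: defs dom_share_def cuts field_simps)
  have pB: "x = 0 \<and> y = 1
      \<or> (\<exists>T. TB = Some T \<and> passB = share T * credit T \<and> x = credit T * (1 - y))"
    if "pB > 0"
    using eq that by (auto simp: equilibrium_iff passB_def defs split: option.splits)
  have cost: "direct_costs w (pol eA sA 0 0) \<pi> CountryA
      = W + (\<delta> * y\<^sup>2 / 2 - \<alpha>A * y) + ((eA + pA + sA) * x - passB * pB * (1 - y))"
    by (simp add: costs defs)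
  \<comment> \<open>If \<open>\<pi>\<^sub>B > 0\<close> then B's scheme binds (or there is autarky), so its refund to B's exporters, an
    implicit transfer to A, is at most what A's exporters pay for certificates.\<close>
  have refund: "\<exists>s\<in>{0..1}. passB * pB * (1 - y) = s * pB * x
      \<and> (s \<le> passB \<or> y = 1 \<and> x = 0)"
  proof (cases "pB > 0")
    case True
    from pB[OF this] show ?thesis
    proof (elim disjE exE conjE)
      fix T assume T: "TB = Some T" "passB = share T * credit T" "x = credit T * (1 - y)"
      have "share T * 1 \<le> share T * credit T"
        using TB_bounds[OF T(1)] by (intro mult_left_mono) auto
      then show ?thesis using TB_bounds[OF T(1)] T by (intro bexI[of _ "share T"]) auto
    qed (auto intro!: bexI[of _ 0])
  next
    case False
    then show ?thesis using E passB_nonneg by (intro bexI[of _ 0]) auto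
  qed
  then obtain s where s: "0 \<le> s" "s \<le> 1" "passB * pB * (1 - y) = s * pB * x"
      "s \<le> passB \<or> y = 1 \<and> x = 0" by auto
  have goal: "XA_bar - production w (pol eA sA 0 0) \<pi> CountryA = 2 * x0 - (x + y)"
    by (simp add: goal_eq production_eq defs)
  show ?thesis
  proof (cases "y \<le> x")
    case True
    have "(\<delta> * x - \<alpha>A) * x \<le> (eA + pA + sA) * x - s * pB * x"
    proof (cases "x = 0")
      case False
      have "s * pB \<le> pB" using s E mult_right_mono[of s 1 pB] by simp
      then have "\<delta> * x - \<alpha>A \<le> eA + pA + sA - s * pB" using xcut False b by simp
      then have "(\<delta> * x - \<alpha>A) * x \<le> (eA + pA + sA - s * pB) * x"
        using b by (intro mult_right_mono) auto
      then show ?thesis by (simp add: algebra_simps)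
    qed simp
    moreover note cost_bound_exports_ge[OF \<eta>A_ge_1 x0_def b(3) True E(3) \<delta>_pos, of \<alpha>A]
    ultimately show ?thesis unfolding cost goal s(3) using x0_bounds(3) by linarith
  next
    case False
    have "pB > 0"
    proof (rule ccontr)
      assume "\<not> pB > 0"
      then have "pB = 0" using E by simp
      then have "dom_cut (pol eA sA 0 0) \<pi> \<le> exp_cut (pol eA sA 0 0) \<pi>"
        using \<open>eA \<ge> 0\<close> \<delta>_pos by (simp add: cuts defs divide_right_mono)
      then have "y \<le> x" by (simp add: defs dom_share_def exp_share_def clip_mono)
      with False show False ..
    qed
    have xy: "1 \<le> x + y"
      using pB[OF \<open>pB > 0\<close>]
    proof (elim disjE exE conjE)
      fix T assume T: "TB = Some T" "x = credit T * (1 - y)"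
      have "1 * (1 - y) \<le> credit T * (1 - y)"
        using TB_bounds[OF T(1)] b by (intro mult_right_mono) auto
      then show ?thesis using T by simp
    qed simp
    \<comment> \<open>Here \<open>ycut\<close> gives the stronger bound. It contains B's price with
      weight \<open>passB\<close>, so the refund is absorbed through \<open>s \<le> passB\<close>
      rather than \<open>s \<le> 1\<close>.\<close>
    have "(\<delta> * y - \<alpha>A) * x \<le> (eA + pA + sA) * x - s * pB * x"
    proof (cases "x = 0")
      case x: False
      with s have "s * pB \<le> passB * pB" using E mult_right_mono[of s passB pB] by simp
      then have "\<delta> * y - \<alpha>A \<le> eA + pA + sA - s * pB" using ycut False b \<open>eA \<ge> 0\<close> by simp
      then have "(\<delta> * y - \<alpha>A) * x \<le> (eA + pA + sA - s * pB) * x"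
        using b by (intro mult_right_mono) auto
      then show ?thesis by (simp add: algebra_simps)
    qed simp
    moreover have "3 / 2 * \<delta> * x0\<^sup>2 - 2 * \<alpha>A * x0
        \<le> \<delta> * y\<^sup>2 / 2 - \<alpha>A * y + (\<delta> * y - \<alpha>A) * x"
      using False b xy \<delta>_pos x0_bounds by (intro cost_bound_exports_less) auto
    moreover have "0 \<le> (\<delta> * x0 - \<alpha>A) * max (2 * x0 - (x + y)) 0"
      using x0_bounds by simp
    ultimately show ?thesis unfolding cost goal s(3) by linarith
  qed
qed

section \<open>The unique market outcome when only B subsidizes\<close>

text \<open>
  The export share at \<open>\<pi>\<^sub>B = 0\<close> when A's scheme binds: the supply curves give \<open>x - y = eB / \<delta>\<close> and
  the scheme gives \<open>\<eta>A * x = 1 - y\<close>.  From \<open>eB = \<delta> / \<eta>A\<close> on, B exports everything (\<open>y = 0\<close>) and only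
  the second equation remains.
\<close>
definition xstar :: "real \<Rightarrow> real" where
  "xstar eB = min ((1 + eB / \<delta>) / (1 + \<eta>A)) (1 / \<eta>A)"

text \<open>A's price is the one that puts \<open>exp_cut\<close> at \<open>xstar eB\<close> while
  B's certificates are free.\<close>

definition least_prices :: "real \<Rightarrow> real \<Rightarrow> country \<Rightarrow> real" where
  "least_prices eB sB = case_country (\<delta> * xstar eB + sB - \<alpha>A) 0"

lemma xstar_mono: "eB \<le> eB' \<Longrightarrow> xstar eB \<le> xstar eB'"
  using \<delta>_pos \<eta>A_ge_1 unfolding xstar_def by (intro min.mono divide_right_mono add_left_mono) auto

lemma xstar_0: "xstar 0 = x0"
  using \<eta>A_ge_1 by (simp add: xstar_def x0_def field_simps)

lemma xstar_bounds:
  assumes "eB \<ge> 0"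
  shows "x0 \<le> xstar eB" "\<eta>A * xstar eB \<le> 1" "xstar eB \<le> 1"
proof -
  show "x0 \<le> xstar eB" using xstar_mono[OF assms] by (simp add: xstar_0)
  have "xstar eB \<le> 1 / \<eta>A" by (simp add: xstar_def)
  then show "\<eta>A * xstar eB \<le> 1" using \<eta>A_ge_1 by (simp add: field_simps)
  moreover have "1 * xstar eB \<le> \<eta>A * xstar eB"
    using \<open>x0 \<le> xstar eB\<close> x0_bounds(1) \<eta>A_ge_1 by (intro mult_right_mono) auto
  ultimately show "xstar eB \<le> 1" by simp
qed

text \<open>The gap between the two sides is the part of \<open>eB\<close> left over once B serves
  all of A's market. It moves no trade and only cheapens A's imports.\<close>

lemma xstar_subsidy:
  "\<delta> * ((1 + \<eta>A) * xstar eB - 1) \<le> eB"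
  "\<eta>A * xstar eB < 1 \<Longrightarrow> \<delta> * ((1 + \<eta>A) * xstar eB - 1) = eB"
proof -
  have "xstar eB \<le> (1 + eB / \<delta>) / (1 + \<eta>A)" by (simp add: xstar_def)
  then have "(1 + \<eta>A) * xstar eB \<le> 1 + eB / \<delta>"
    using \<eta>A_ge_1 by (simp add: pos_le_divide_eq mult.commute)
  then have "\<delta> * ((1 + \<eta>A) * xstar eB - 1) \<le> \<delta> * (eB / \<delta>)"
    using \<delta>_pos by (intro mult_left_mono) auto
  then show "\<delta> * ((1 + \<eta>A) * xstar eB - 1) \<le> eB" using \<delta>_pos by simp
  assume "\<eta>A * xstar eB < 1"
  then have "xstar eB < 1 / \<eta>A" using \<eta>A_ge_1 by (simp add: field_simps)
  then have "xstar eB = (1 + eB / \<delta>) / (1 + \<eta>A)" by (auto simp: xstar_def min_def split: if_splits)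
  then have "(1 + \<eta>A) * xstar eB = 1 + eB / \<delta>" using \<eta>A_ge_1 by simp
  then show "\<delta> * ((1 + \<eta>A) * xstar eB - 1) = eB" using \<delta>_pos by simp
qed

text \<open>Clipping at 0 sets in exactly where the minimum in \<open>xstar\<close> switches, so A's
  scheme binds in both regimes.\<close>

lemma dom_share_xstar:
  assumes "eB \<ge> 0"
  shows "clip (xstar eB - eB / \<delta>) = 1 - \<eta>A * xstar eB"
proof (cases "\<eta>A * xstar eB < 1")
  case True
  have "0 \<le> \<eta>A * xstar eB"
    using xstar_bounds(1)[OF assms] x0_bounds(1) \<eta>A_ge_1 by (intro mult_nonneg_nonneg) auto
  moreover have "xstar eB - eB / \<delta> = 1 - \<eta>A * xstar eB"
    using xstar_subsidy(2)[OF True] \<delta>_pos by (simp add: field_simps)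
  ultimately show ?thesis using True by (simp add: clip_id)
next
  case False
  then have 1: "\<eta>A * xstar eB = 1" using xstar_bounds(2)[OF assms] by simp
  then have "\<delta> * xstar eB \<le> eB" using xstar_subsidy(1)[of eB] by (simp add: algebra_simps)
  then have "xstar eB - eB / \<delta> \<le> 0" using \<delta>_pos by (simp add: field_simps)
  then show ?thesis using 1 by (simp add: clip_def)
qed

lemma shares_least_prices:
  assumes "eB \<ge> 0"
  shows "exp_share (pol 0 0 eB sB) (least_prices eB sB) = xstar eB"
    and "dom_share (pol 0 0 eB sB) (least_prices eB sB) = 1 - \<eta>A * xstar eB"
proof -
  have "exp_cut (pol 0 0 eB sB) (least_prices eB sB) = xstar eB"
    "dom_cut (pol 0 0 eB sB) (least_prices eB sB) = xstar eB - eB / \<delta>"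
    using \<delta>_pos by (simp_all add: cuts least_prices_def field_simps)
  then show "exp_share (pol 0 0 eB sB) (least_prices eB sB) = xstar eB"
    and "dom_share (pol 0 0 eB sB) (least_prices eB sB) = 1 - \<eta>A * xstar eB"
    using xstar_bounds[OF assms] x0_bounds(1)
    by (simp_all add: exp_share_def dom_share_def dom_share_xstar[OF assms] clip_id)
qed

text \<open>A's price is positive because \<open>\<alpha>A < \<delta> * x0\<close>, that is, the
  goal exceeds free trade production. B's scheme clears at price zero because B exports
  \<open>\<eta>A * x \<ge> x\<close> and has a credit factor of at least 1.\<close>

lemma equilibrium_least_prices:
  assumes "eB \<ge> 0" "sB \<ge> 0"
  shows "equilibrium w (pol 0 0 eB sB) (least_prices eB sB)"
proof -
  note b = xstar_bounds[OF assms(1)]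
  have pos: "xstar eB > 0" using b x0_bounds by simp
  have "\<delta> * x0 \<le> \<delta> * xstar eB" using b \<delta>_pos by simp
  then have price: "\<alpha>A \<le> \<delta> * xstar eB + sB" using x0_bounds assms by linarith
  have mult: "xstar eB \<le> c * (\<eta>A * xstar eB)" if "c \<ge> 1" for c
    using that \<eta>A_ge_1 pos mult_mono[of 1 c 1 \<eta>A] mult_right_mono[of 1 "c * \<eta>A" "xstar eB"]
    by (simp add: mult.assoc)
  have "0 < \<eta>A * xstar eB" using pos \<eta>A_ge_1 by simp
  then show ?thesis
    unfolding equilibrium_iff shares_least_prices[OF assms(1)]
    using price mult TB_bounds by (auto simp: least_prices_def split: option.splits)
qed

lemma least_prices_le:
  assumes "eB \<ge> 0" and eq: "equilibrium w (pol 0 0 eB sB) \<pi>"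
  shows "least_prices eB sB i \<le> \<pi> i"
proof (cases i)
  case CountryB
  then show ?thesis using equilibrium_constraints(2)[OF eq] by (simp add: least_prices_def)
next
  case CountryA
  note E = equilibrium_constraints[OF eq]
  show ?thesis
  proof (rule ccontr)
    assume "\<not> ?thesis"
    then have less: "\<pi> CountryA < \<delta> * xstar eB + sB - \<alpha>A"
      by (simp add: CountryA least_prices_def)
    have "exp_cut (pol 0 0 eB sB) \<pi> < xstar eB"
      using less E \<delta>_pos by (simp add: cuts field_simps)
    \<comment> \<open>Strictness survives the clipping because \<open>xstar eB\<close> is
      positive.\<close>
    then have x: "exp_share (pol 0 0 eB sB) \<pi> < xstar eB"
      using xstar_bounds(1)[OF assms(1)] x0_bounds(1) by (auto simp: exp_share_def clip_def)
    have "passB * \<pi> CountryB \<ge> 0" using E passB_nonneg by simp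
    then have "(\<alpha>A + 0 - sB - eB - passB * \<pi> CountryB + \<pi> CountryA) / \<delta>
        \<le> (\<delta> * xstar eB - eB) / \<delta>"
      using less \<delta>_pos by (intro divide_right_mono) auto
    then have "dom_cut (pol 0 0 eB sB) \<pi> \<le> xstar eB - eB / \<delta>"
      using \<delta>_pos by (simp add: cuts diff_divide_distrib)
    then have y: "dom_share (pol 0 0 eB sB) \<pi> \<le> 1 - \<eta>A * xstar eB"
      unfolding dom_share_def dom_share_xstar[OF assms(1), symmetric] by (rule clip_mono)
    have "\<eta>A * exp_share (pol 0 0 eB sB) \<pi> < \<eta>A * xstar eB"
      using x \<eta>A_ge_1 by simp
    with y E(3) show False by linarith
  qed
qed

text \<open>A componentwise least equilibrium is the only minimal one.\<close>

lemma market_outcome_iff: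
  assumes "eB \<ge> 0" "sB \<ge> 0"
  shows "market_outcome w (pol 0 0 eB sB) \<pi> \<longleftrightarrow> \<pi> = least_prices eB sB"
proof
  assume "market_outcome w (pol 0 0 eB sB) \<pi>"
  then show "\<pi> = least_prices eB sB"
    using equilibrium_least_prices[OF assms] least_prices_le[OF assms(1)]
    unfolding market_outcome_def by blast
next
  assume \<pi>: "\<pi> = least_prices eB sB"
  show "market_outcome w (pol 0 0 eB sB) \<pi>"
    using equilibrium_least_prices[OF assms] least_prices_le[OF assms(1)]
    unfolding market_outcome_def \<pi> by (auto simp: fun_eq_iff intro: order.antisym)
qed

section \<open>Costs and production at that outcome\<close>

lemma outcome_costs_A:
  assumes "eB \<ge> 0"
  shows "direct_costs w (pol 0 0 eB sB) (least_prices eB sB) CountryA = W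
    + (\<delta> * (1 - \<eta>A * xstar eB)\<^sup>2 / 2 - \<alpha>A * (1 - \<eta>A * xstar eB))
    + (\<delta> * xstar eB + sB - \<alpha>A) * xstar eB - (sB + eB) * (\<eta>A * xstar eB)"
  unfolding costs shares_least_prices[OF assms] by (simp add: least_prices_def)

lemma outcome_costs_B:
  assumes "eB \<ge> 0"
  shows "direct_costs w (pol 0 0 eB sB) (least_prices eB sB) CountryB = W
    + (\<delta> * (xstar eB)\<^sup>2 / 2 - \<alpha>A * xstar eB)
    - (\<delta> * xstar eB + sB - \<alpha>A) * xstar eB + (sB + eB) * (\<eta>A * xstar eB)"
  unfolding costs shares_least_prices[OF assms] by (simp add: least_prices_def)

lemma outcome_production:
  assumes "eB \<ge> 0"
  shows "production w (pol 0 0 eB sB) (least_prices eB sB) CountryA = 1 - (\<eta>A - 1) * xstar eB"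
    and "production w (pol 0 0 eB sB) (least_prices eB sB) CountryB = 1 + (\<eta>A - 1) * xstar eB"
  by (simp_all add: production_eq shares_least_prices[OF assms] algebra_simps)

lemma no_deviation_A:
  assumes "\<delta> * x0 - \<alpha>A \<le> lam" "eA \<ge> 0" "sA \<ge> 0" "equilibrium w (pol eA sA 0 0) \<pi>"
  shows "utility_A lam XA_bar w (pol eA sA 0 0) \<pi>
    \<le> utility_A lam XA_bar w (pol 0 0 0 0) (least_prices 0 0)"
proof -
  let ?gap = "max (XA_bar - production w (pol eA sA 0 0) \<pi> CountryA) 0"
  have x0: "1 - \<eta>A * x0 = x0"
    using \<eta>A_ge_1 by (simp add: x0_def field_simps)
  have "direct_costs w (pol 0 0 0 0) (least_prices 0 0) CountryA
      = W + (3 / 2 * \<delta> * x0\<^sup>2 - 2 * \<alpha>A * x0)"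
    using outcome_costs_A[of 0 0] unfolding xstar_0 x0
    by (simp add: algebra_simps power2_eq_square)
  moreover have prod: "production w (pol 0 0 0 0) (least_prices 0 0) CountryA = XA_bar"
  proof -
    have "production w (pol 0 0 0 0) (least_prices 0 0) CountryA = 1 - (\<eta>A - 1) * x0"
      by (simp add: outcome_production xstar_0)
    also have "\<dots> = XA_bar" using x0 by (simp add: goal_eq algebra_simps)
    finally show ?thesis .
  qed
  moreover have "(\<delta> * x0 - \<alpha>A) * ?gap \<le> lam * ?gap"
    using assms by (intro mult_right_mono) auto
  ultimately show ?thesis
    using deviation_A_costs[OF assms(4,2,3)] unfolding utility_A_def prod by simp
qed

section \<open>Deviations of B\<close>

text \<open>B's utility along the export-subsidy path, as a function of A's export share, as long as \<open>y > 0\<close>.\<close>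
definition uB :: "real \<Rightarrow> real \<Rightarrow> real" where
  "uB \<gamma> x = \<gamma> * (1 + (\<eta>A - 1) * x) - W + \<delta> * \<eta>A * x - \<delta> * (\<eta>A\<^sup>2 + \<eta>A - 1 / 2) * x\<^sup>2"

text \<open>\<open>sB\<close> leaves trade unchanged because A's certificate price rises one for one
  with it. B pays it on \<open>\<eta>A * x\<close> exports and recovers it on \<open>x\<close>
  imports, a net loss. The last term is the export subsidy wasted after B serves all of A's
  market.\<close>

lemma outcome_utility_B:
  assumes "eB \<ge> 0"
  shows "utility_B \<gamma> w (pol 0 0 eB sB) (least_prices eB sB) = uB \<gamma> (xstar eB)
    - (\<eta>A - 1) * sB * xstar eB
    - (eB - \<delta> * ((1 + \<eta>A) * xstar eB - 1)) * (\<eta>A * xstar eB)"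
  unfolding utility_B_def outcome_costs_B[OF assms] outcome_production[OF assms] uB_def
  by (simp add: field_simps power2_eq_square)

lemma uB_increment:
  "uB \<gamma> (x0 + h) - uB \<gamma> x0
    = h * ((\<gamma> * (\<eta>A - 1) - \<delta> * (\<eta>A\<^sup>2 + \<eta>A - 1) * x0) - \<delta> * (\<eta>A\<^sup>2 + \<eta>A - 1 / 2) * h)"
proof -
  have \<eta>: "\<eta>A * x0 = 1 - x0" using \<eta>A_ge_1 by (simp add: x0_def field_simps)
  \<comment> \<open>The factor \<open>x0 + \<eta>A * x0 = 1\<close> is inserted to make the whole
    \<open>\<delta>\<close> part of the slope a multiple of \<open>x0\<close>.\<close>
  have "uB \<gamma> (x0 + h) - uB \<gamma> x0
    = h * ((\<gamma> * (\<eta>A - 1) + \<delta> * \<eta>A * (x0 + \<eta>A * x0) - \<delta> * (2 * \<eta>A\<^sup>2 + 2 * \<eta>A - 1) * x0)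
        - \<delta> * (\<eta>A\<^sup>2 + \<eta>A - 1 / 2) * h)"
    using \<eta> by (simp add: uB_def) (simp add: field_simps power2_eq_square)
  then show ?thesis by (simp add: algebra_simps power2_eq_square)
qed

lemma curvature_pos: "0 < \<eta>A\<^sup>2 + \<eta>A - 1 / 2"
  using \<eta>A_ge_1 zero_le_power2[of \<eta>A] by linarith

lemma marginal_gain:
  assumes \<eta>: "\<eta>A > 1"
  shows "\<gamma> * (\<eta>A - 1) - \<delta> * (\<eta>A\<^sup>2 + \<eta>A - 1) * x0 = (\<eta>A - 1) * (\<gamma> - gamma_B_TIC \<delta> \<eta>A)"
proof -
  have "\<eta>A\<^sup>2 - 1 = (\<eta>A - 1) * (1 + \<eta>A)" by (simp add: power2_eq_square algebra_simps)
  then have "gamma_B_TIC \<delta> \<eta>A * (\<eta>A - 1) = \<delta> * (\<eta>A\<^sup>2 + \<eta>A - 1) * x0"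
    using \<eta> by (simp add: gamma_B_TIC_def x0_def)
  then show ?thesis by (simp add: left_diff_distrib right_diff_distrib mult.commute)
qed

lemma baseline_utility_B: "utility_B \<gamma> w (pol 0 0 0 0) (least_prices 0 0) = uB \<gamma> x0"
  using outcome_utility_B[of 0 \<gamma> 0] x0_bounds(1) \<eta>A_ge_1
  by (simp add: xstar_0) (simp add: x0_def)

lemma no_deviation_B:
  assumes "eB \<ge> 0" "sB \<ge> 0" and "\<eta>A = 1 \<or> \<eta>A > 1 \<and> \<gamma> \<le> gamma_B_TIC \<delta> \<eta>A"
  shows "utility_B \<gamma> w (pol 0 0 eB sB) (least_prices eB sB)
    \<le> utility_B \<gamma> w (pol 0 0 0 0) (least_prices 0 0)"
proof -
  define h where "h = xstar eB - x0"
  have h: "h \<ge> 0" "xstar eB = x0 + h" using xstar_bounds(1)[OF assms(1)] by (simp_all add: h_def)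
  \<comment> \<open>The slope at \<open>x0\<close>. For \<open>\<eta>A = 1\<close> the production
    gain drops out and the slope is negative whatever \<open>\<gamma>\<close> is.\<close>
  have K: "\<gamma> * (\<eta>A - 1) - \<delta> * (\<eta>A\<^sup>2 + \<eta>A - 1) * x0 \<le> 0"
  proof (cases "\<eta>A = 1")
    case True
    then show ?thesis using \<delta>_pos x0_bounds by simp
  next
    case False
    then show ?thesis
      using assms(3) by (auto simp: marginal_gain intro!: mult_nonneg_nonpos)
  qed
  have "0 \<le> \<delta> * (\<eta>A\<^sup>2 + \<eta>A - 1 / 2) * h"
    using \<delta>_pos curvature_pos h(1) by (intro mult_nonneg_nonneg) linarith+
  with K have "uB \<gamma> (x0 + h) - uB \<gamma> x0 \<le> 0"
    unfolding uB_increment using h by (intro mult_nonneg_nonpos) auto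
  moreover have "0 \<le> (\<eta>A - 1) * sB * xstar eB"
    "0 \<le> (eB - \<delta> * ((1 + \<eta>A) * xstar eB - 1)) * (\<eta>A * xstar eB)"
    using assms(2) \<eta>A_ge_1 h x0_bounds(1) xstar_subsidy(1)[of eB]
    by (auto intro!: mult_nonneg_nonneg)
  ultimately show ?thesis
    unfolding outcome_utility_B[OF assms(1)] baseline_utility_B using h(2) by simp
qed

lemma profitable_deviation_B:
  assumes "\<eta>A > 1" "\<gamma> > gamma_B_TIC \<delta> \<eta>A"
  shows "\<exists>eB>0. utility_B \<gamma> w (pol 0 0 eB 0) (least_prices eB 0)
    > utility_B \<gamma> w (pol 0 0 0 0) (least_prices 0 0)"
proof -
  define K where "K = \<gamma> * (\<eta>A - 1) - \<delta> * (\<eta>A\<^sup>2 + \<eta>A - 1) * x0"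
  define c where "c = \<delta> * (\<eta>A\<^sup>2 + \<eta>A - 1 / 2)"
  \<comment> \<open>\<open>K / (2 * c)\<close> maximizes \<open>h * (K - c * h)\<close>; the cap
    keeps \<open>x0 + h\<close> below the point where B serves all of A's market.\<close>
  define h where "h = min (K / (2 * c)) (1 / \<eta>A - x0)"
  have K: "K > 0" using assms by (simp add: K_def marginal_gain)
  have c: "c > 0" unfolding c_def using \<delta>_pos curvature_pos by (rule mult_pos_pos)
  have "x0 < 1 / \<eta>A" using assms by (simp add: x0_def field_simps)
  then have h: "h > 0" using K c by (simp add: h_def)
  have "c * h \<le> c * (K / (2 * c))" using c by (intro mult_left_mono) (auto simp: h_def)
  then have "c * h < K" using c K by simp
  then have "0 < h * (K - c * h)" using h by simp
  then have gain: "uB \<gamma> (x0 + h) > uB \<gamma> x0"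
    using uB_increment[of \<gamma> h] unfolding K_def c_def by linarith
  \<comment> \<open>The subsidy at which the first branch of \<open>xstar\<close> equals
    \<open>x0 + h\<close>.\<close>
  define eB where "eB = \<delta> * (1 + \<eta>A) * h"
  have eB: "eB > 0" using h \<delta>_pos assms by (simp add: eB_def)
  have "(1 + eB / \<delta>) / (1 + \<eta>A) = x0 + h"
    using \<delta>_pos assms by (simp add: eB_def x0_def add_divide_distrib)
  moreover have "x0 + h \<le> 1 / \<eta>A" by (simp add: h_def)
  ultimately have xs: "xstar eB = x0 + h" by (simp add: xstar_def)
  have "(1 + \<eta>A) * x0 = 1" using assms by (simp add: x0_def)
  then have "\<delta> * ((1 + \<eta>A) * xstar eB - 1) = eB"
    unfolding xs unfolding eB_def by (simp add: distrib_left)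
  then have "utility_B \<gamma> w (pol 0 0 eB 0) (least_prices eB 0) = uB \<gamma> (x0 + h)"
    using outcome_utility_B[of eB \<gamma> 0] eB by (simp add: xs)
  with gain eB show ?thesis by (auto simp: baseline_utility_B)
qed

section \<open>A's costs as B's subsidies rise\<close>

text \<open>The cost splits into \<open>g x\<close>, where \<open>eB\<close> is expressed through
  \<open>x\<close>, minus the excess export subsidy and minus the net gain from \<open>sB\<close>.
  Each contribution is monotone separately.\<close>

lemma outcome_costs_A_antimono:
  assumes "0 \<le> eB" "eB \<le> eB'" "0 \<le> sB" "sB \<le> sB'"
  shows "direct_costs w (pol 0 0 eB' sB') (least_prices eB' sB') CountryA
    \<le> direct_costs w (pol 0 0 eB sB) (least_prices eB sB) CountryA"
proof -
  define x where "x = xstar eB"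
  define x' where "x' = xstar eB'"
  define g where "g x = \<delta> * (1 - \<eta>A * x)\<^sup>2 / 2 - \<alpha>A * (1 - (\<eta>A - 1) * x) + \<delta> * x\<^sup>2
    - \<delta> * ((1 + \<eta>A) * x - 1) * (\<eta>A * x)" for x
  define r where "r = eB - \<delta> * ((1 + \<eta>A) * x - 1)"
  define r' where "r' = eB' - \<delta> * ((1 + \<eta>A) * x' - 1)"
  have x: "x0 \<le> x" "x \<le> x'" "\<eta>A * x' \<le> 1"
    using xstar_bounds xstar_mono assms by (auto simp: x_def x'_def)
  have cost: "direct_costs w (pol 0 0 eB sB) (least_prices eB sB) CountryA
      = W + g x - r * (\<eta>A * x) - (\<eta>A - 1) * sB * x"
    "direct_costs w (pol 0 0 eB' sB') (least_prices eB' sB') CountryA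
      = W + g x' - r' * (\<eta>A * x') - (\<eta>A - 1) * sB' * x'"
    using assms by (simp_all add: outcome_costs_A x_def x'_def r_def r'_def g_def
        algebra_simps power2_eq_square)
  have s: "(\<eta>A - 1) * sB * x \<le> (\<eta>A - 1) * sB' * x'"
    using x x0_bounds(1) assms \<eta>A_ge_1 by (intro mult_mono) auto
  \<comment> \<open>The excess is zero until \<open>\<eta>A * x = 1\<close>; from there on
    \<open>x\<close> stays fixed and only \<open>eB\<close> grows.\<close>
  have r: "r * (\<eta>A * x) \<le> r' * (\<eta>A * x')"
  proof (cases "\<eta>A * x < 1")
    case True
    then have "r = 0" using xstar_subsidy(2)[of eB] by (simp add: r_def x_def)
    then show ?thesis
      using xstar_subsidy(1)[of eB'] x x0_bounds(1) \<eta>A_ge_1 by (simp add: r'_def x'_def)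
  next
    case False
    have "\<eta>A * x \<le> \<eta>A * x'" using x \<eta>A_ge_1 by simp
    then have "\<eta>A * x = \<eta>A * x'" using False x(3) by linarith
    then have "x = x'" using \<eta>A_ge_1 by simp
    then show ?thesis using False assms by (simp add: r_def r'_def mult_right_mono)
  qed
  \<comment> \<open>The linear terms of \<open>g\<close> with factor \<open>\<delta>\<close> cancel,
    so \<open>g\<close> is a concave quadratic whose only linear term comes from
    \<open>\<alpha>A\<close>.\<close>
  have "g x - g x' = (x' - x) * ((\<eta>A\<^sup>2 / 2 + \<eta>A - 1) * \<delta> * (x + x') - (\<eta>A - 1) * \<alpha>A)"
    by (simp add: g_def field_simps power2_eq_square)
  moreover have "(\<eta>A - 1) * \<alpha>A \<le> (\<eta>A\<^sup>2 / 2 + \<eta>A - 1) * \<delta> * (x + x')"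
  proof -
    have "\<delta> * x0 \<le> \<delta> * (x + x')" using x x0_bounds(1) \<delta>_pos by (intro mult_left_mono) auto
    then have "\<alpha>A \<le> \<delta> * (x + x')" using x0_bounds(3) by linarith
    then have "(\<eta>A - 1) * \<alpha>A \<le> (\<eta>A\<^sup>2 / 2 + \<eta>A - 1) * (\<delta> * (x + x'))"
      using \<eta>A_ge_1 \<alpha>A_pos zero_le_power2[of \<eta>A] by (intro mult_mono) linarith+
    then show ?thesis by (simp add: mult.assoc)
  qed
  ultimately have "g x' \<le> g x" using x(2) by (smt (verit) mult_nonneg_nonneg)
  with s r show ?thesis unfolding cost by linarith
qed

end

theorem proposition6:
  fixes w :: "country \<Rightarrow> real \<Rightarrow> real"
    and \<alpha>A \<alpha>B \<delta> XA_bar \<phi>A \<eta>A \<gamma>B :: real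
    and TB :: "tic_scheme option"
  assumes "\<alpha>A > 0" and "\<alpha>B > 0" and "\<delta> = \<alpha>A + \<alpha>B"
    and "\<And>i. set_integrable lborel {0..1} (w i)"
    and "\<And>m. m \<in> {0..1} \<Longrightarrow> w CountryA m - w CountryB m = - \<alpha>A + \<delta> * m"
    and "\<alpha>A \<le> \<alpha>B"
    and "2 * \<alpha>A / \<delta> < XA_bar" and "XA_bar \<le> 1" \<comment> \<open>the case \<open>XA_bar = 1\<close>, i.e. \<open>\<eta>A = 1\<close>, is the one considered first in (ii)\<close>
    and "\<gamma>B > 0"
    and "\<eta>A = agreement_credit XA_bar"
    and "\<phi>A \<in> {0..1}" and "\<phi>A * \<eta>A = 1"
    and "\<And>T. TB = Some T \<Longrightarrow> credit T \<ge> 1 \<and> share T \<in> {0..1}"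
  shows "\<forall>\<^sub>F lamA in at_top.
    \<comment> \<open>(i), whatever equilibrium follows the deviation\<close>
    (\<forall>\<pi> eA sA \<pi>'.
       market_outcome w (tic_agreement XA_bar \<phi>A TB 0 0 0 0) \<pi> \<and>
       eA \<ge> 0 \<and> sA \<ge> 0 \<and> (eA > 0 \<or> sA > 0) \<and>
       equilibrium w (tic_agreement XA_bar \<phi>A TB eA sA 0 0) \<pi>' \<longrightarrow>
       utility_A lamA XA_bar w (tic_agreement XA_bar \<phi>A TB eA sA 0 0) \<pi>'
         \<le> utility_A lamA XA_bar w (tic_agreement XA_bar \<phi>A TB 0 0 0 0) \<pi>) \<and>
    \<comment> \<open>(ii)\<close>
    (\<eta>A = 1 \<longrightarrow>
      (\<forall>\<pi> eB sB \<pi>'.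
         market_outcome w (tic_agreement XA_bar \<phi>A TB 0 0 0 0) \<pi> \<and>
         eB \<ge> 0 \<and> sB \<ge> 0 \<and> (eB > 0 \<or> sB > 0) \<and>
         market_outcome w (tic_agreement XA_bar \<phi>A TB 0 0 eB sB) \<pi>' \<longrightarrow>
         utility_B \<gamma>B w (tic_agreement XA_bar \<phi>A TB 0 0 eB sB) \<pi>'
           \<le> utility_B \<gamma>B w (tic_agreement XA_bar \<phi>A TB 0 0 0 0) \<pi>)) \<and>
    (\<eta>A > 1 \<longrightarrow>
      ((\<exists>\<pi> eB \<pi>'.
         market_outcome w (tic_agreement XA_bar \<phi>A TB 0 0 0 0) \<pi> \<and>
         eB > 0 \<and>
         market_outcome w (tic_agreement XA_bar \<phi>A TB 0 0 eB 0) \<pi>' \<and>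
         utility_B \<gamma>B w (tic_agreement XA_bar \<phi>A TB 0 0 eB 0) \<pi>'
           > utility_B \<gamma>B w (tic_agreement XA_bar \<phi>A TB 0 0 0 0) \<pi>)
       \<longleftrightarrow> \<gamma>B > gamma_B_TIC \<delta> \<eta>A)) \<and>
    filterlim (gamma_B_TIC \<delta>) at_top (at_right 1) \<and>
    \<comment> \<open>(iii)\<close>
    (\<forall>eB sB \<pi>.
       eB \<ge> 0 \<and> sB \<ge> 0 \<and>
       equilibrium w (tic_agreement XA_bar \<phi>A TB 0 0 eB sB) \<pi> \<longrightarrow>
       production w (tic_agreement XA_bar \<phi>A TB 0 0 eB sB) \<pi> CountryA \<ge> 1 / \<eta>A) \<and>
    (\<forall>eB sB eB' sB' \<pi> \<pi>'.
       0 \<le> eB \<and> eB \<le> eB' \<and> 0 \<le> sB \<and> sB \<le> sB' \<and>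
       market_outcome w (tic_agreement XA_bar \<phi>A TB 0 0 eB sB) \<pi> \<and>
       market_outcome w (tic_agreement XA_bar \<phi>A TB 0 0 eB' sB') \<pi>' \<longrightarrow>
       direct_costs w (tic_agreement XA_bar \<phi>A TB 0 0 eB' sB') \<pi>' CountryA
         \<le> direct_costs w (tic_agreement XA_bar \<phi>A TB 0 0 eB sB) \<pi> CountryA)"
proof -
  interpret tic_agreement_setting w \<alpha>A \<alpha>B \<delta> XA_bar \<phi>A \<eta>A TB
    by unfold_locales (use assms in auto)
  have incentive: "(\<exists>\<pi> eB \<pi>'. market_outcome w (pol 0 0 0 0) \<pi> \<and> eB > 0 \<and>
      market_outcome w (pol 0 0 eB 0) \<pi>' \<and>
      utility_B \<gamma>B w (pol 0 0 eB 0) \<pi>' > utility_B \<gamma>B w (pol 0 0 0 0) \<pi>)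
      \<longleftrightarrow> \<gamma>B > gamma_B_TIC \<delta> \<eta>A" (is "?L \<longleftrightarrow> ?R") if "\<eta>A > 1"
  proof
    assume ?L
    then obtain eB where "eB > 0" "utility_B \<gamma>B w (pol 0 0 eB 0) (least_prices eB 0)
        > utility_B \<gamma>B w (pol 0 0 0 0) (least_prices 0 0)"
      by (auto simp: market_outcome_iff)
    then show ?R
      using no_deviation_B[of eB 0 \<gamma>B] that by fastforce
  next
    assume ?R
    from profitable_deviation_B[OF that this] show ?L
      by (auto simp: market_outcome_iff)
  qed
  have stay: "utility_B \<gamma>B w (pol 0 0 eB sB) \<pi>' \<le> utility_B \<gamma>B w (pol 0 0 0 0) \<pi>"
    if "\<eta>A = 1" "market_outcome w (pol 0 0 0 0) \<pi> \<and> eB \<ge> 0 \<and> sB \<ge> 0 \<and> (eB > 0 \<or> sB > 0)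
      \<and> market_outcome w (pol 0 0 eB sB) \<pi>'" for \<pi> eB sB \<pi>'
    using that(2) no_deviation_B[OF _ _ disjI1[OF that(1)]] by (auto simp: market_outcome_iff)
  have antimono: "direct_costs w (pol 0 0 eB' sB') \<pi>' CountryA
      \<le> direct_costs w (pol 0 0 eB sB) \<pi> CountryA"
    if "0 \<le> eB \<and> eB \<le> eB' \<and> 0 \<le> sB \<and> sB \<le> sB' \<and> market_outcome w (pol 0 0 eB sB) \<pi>
      \<and> market_outcome w (pol 0 0 eB' sB') \<pi>'" for eB sB eB' sB' \<pi> \<pi>'
  proof -
    have "0 \<le> eB'" "0 \<le> sB'" using that by auto
    with that show ?thesis by (auto simp: market_outcome_iff intro: outcome_costs_A_antimono)
  qed
  have deter: "utility_A lamA XA_bar w (pol eA sA 0 0) \<pi>'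
      \<le> utility_A lamA XA_bar w (pol 0 0 0 0) \<pi>"
    if "\<delta> * x0 - \<alpha>A \<le> lamA" "market_outcome w (pol 0 0 0 0) \<pi> \<and> eA \<ge> 0 \<and> sA \<ge> 0
      \<and> (eA > 0 \<or> sA > 0) \<and> equilibrium w (pol eA sA 0 0) \<pi>'" for lamA \<pi> eA sA \<pi>'
    using that no_deviation_A by (auto simp: market_outcome_iff)
  show ?thesis
    \<comment> \<open>Only (i) involves \<open>lamA\<close>, and the weight it requires depends on
      \<open>\<delta>\<close>, \<open>\<alpha>A\<close> and \<open>\<eta>A\<close> alone.\<close>
    using eventually_ge_at_top[of "\<delta> * x0 - \<alpha>A"]
  proof eventually_elim
    case (elim lamA)
    show ?case
    proof (intro conjI allI impI gamma_B_TIC_at_top \<delta>_pos, goal_cases)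
      case 1
      then show ?case by (rule deter[OF elim])
    next
      case 2
      then show ?case by (rule stay)
    next
      case 3
      then show ?case by (rule incentive)
    next
      case 4
      then show ?case by (blast intro: production_A_ge)
    next
      case 5
      then show ?case by (rule antimono)
    qed
  qed
qed

end
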